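(* (i) For all integers $n,d$ with $d\equiv 8\pmod{10}$, $d\ge 8$, $n\ge 4d+6$ and $n\equiv 0\pmod{10}$, we have $\gamma^{LD}(C_n(1,d-1,d,d+1))=\frac n5$. (ii) There exist integers $n_k$, $d_k\ge 3$ with $d_k+1\le n_k/2$ and identifying codes $C_k$ in the circulant graphs $C_{n_k}(1,d_k-1,d_k,d_k+1)$ ($k=1,2,\dots$) such that $\lim_{k\to\infty}|C_k|/n_k=2/9$.
   Context: All graphs are simple and undirected. For a graph $G=(V,E)$ and $u\in V$, $N[u]=\{u\}\cup\{v: uv\in E\}$. A code is a nonempty $C\subseteq V$, and $I(C;u)=N[u]\cap C$. $C$ is dominating if $I(C;u)\neq\emptyset$ for all $u$; identifying if dominating and $I(C;u)\neq I(C;v)$ for all distinct $u,v\in V$; locating-dominating if dominating and $I(C;u)\neq I(C;v)$ for all distinct $u,v\in V\setminus C$. $\gamma^{LD}(G)$ denotes the minimum cardinality of a locating-dominating code in a finite graph $G$. For positive integers $n$ and $d_1,\dots,d_k\le n/2$, the circulant graph $C_n(d_1,\dots,d_k)$ has vertex set $\mathbb{Z}_n$, and the open neighbourhood of $u$ is $\{u\pm d_1,\dots,u\pm d_k\}$ modulo $n$. *)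

theory Defs
  imports Complex_Main "HOL-Number_Theory.Cong"
begin

text \<open>A graph is a pair of a vertex set and a set of edges, an edge being the set of its two ends.\<close>

type_synonym 'a ugraph = "'a set \<times> 'a set set"

abbreviation verts :: "'a ugraph \<Rightarrow> 'a set" where
  "verts G \<equiv> fst G"

abbreviation edges :: "'a ugraph \<Rightarrow> 'a set set" where
  "edges G \<equiv> snd G"

definition simple_graph :: "'a ugraph \<Rightarrow> bool" where
  "simple_graph G \<longleftrightarrow> (\<forall>e\<in>edges G. e \<subseteq> verts G \<and> card e = 2)"

definition closed_nbhd :: "'a ugraph \<Rightarrow> 'a \<Rightarrow> 'a set" where
  "closed_nbhd G u = {u} \<union> {v. {u, v} \<in> edges G}"

definition is_code :: "'a ugraph \<Rightarrow> 'a set \<Rightarrow> bool" where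
  "is_code G C \<longleftrightarrow> C \<noteq> {} \<and> C \<subseteq> verts G"

definition I_set :: "'a ugraph \<Rightarrow> 'a set \<Rightarrow> 'a \<Rightarrow> 'a set" where
  "I_set G C u = closed_nbhd G u \<inter> C"

definition dominating_code :: "'a ugraph \<Rightarrow> 'a set \<Rightarrow> bool" where
  "dominating_code G C \<longleftrightarrow> is_code G C \<and> (\<forall>u\<in>verts G. I_set G C u \<noteq> {})"

definition identifying_code :: "'a ugraph \<Rightarrow> 'a set \<Rightarrow> bool" where
  "identifying_code G C \<longleftrightarrow> dominating_code G C \<and>
     (\<forall>u\<in>verts G. \<forall>v\<in>verts G. u \<noteq> v \<longrightarrow> I_set G C u \<noteq> I_set G C v)"

definition locating_dominating_code :: "'a ugraph \<Rightarrow> 'a set \<Rightarrow> bool" where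
  "locating_dominating_code G C \<longleftrightarrow> dominating_code G C \<and>
     (\<forall>u\<in>verts G - C. \<forall>v\<in>verts G - C. u \<noteq> v \<longrightarrow> I_set G C u \<noteq> I_set G C v)"

text \<open>Only meaningful for finite nonempty graphs, where the whole vertex set is a
  locating-dominating code and so the minimum is over a finite nonempty set.\<close>

definition gamma_LD :: "'a ugraph \<Rightarrow> nat" where
  "gamma_LD G = Min (card ` {C. locating_dominating_code G C})"

text \<open>The residues modulo \<open>n\<close> are represented by \<open>0, \<dots>, n - 1\<close>. The definition is meant for
  \<open>0 < d\<close> and \<open>2 * d \<le> n\<close> for all \<open>d \<in> D\<close>.\<close>

definition circulant :: "int \<Rightarrow> int set \<Rightarrow> int ugraph" where
  "circulant n D =
     ({0..<n},
      {{u, v} |u v. u \<in> {0..<n} \<and> v \<in> {0..<n} \<and>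
         (\<exists>d\<in>D. [v = u + d] (mod n) \<or> [v = u - d] (mod n))})"

lemma circulant_edge_iff:
  "{u, v} \<in> edges (circulant n D) \<longleftrightarrow> u \<in> {0..<n} \<and> v \<in> {0..<n} \<and>
     (\<exists>d\<in>D. [v = u + d] (mod n) \<or> [v = u - d] (mod n))"
proof -
  have "[u = v + d] (mod n) \<longleftrightarrow> [v = u - d] (mod n)" for u v d :: int
    by (simp add: cong_iff_dvd_diff) (metis add_diff_cancel_right' diff_diff_eq2 dvd_minus_iff minus_diff_eq add.commute)
  moreover from this have "[u = v - d] (mod n) \<longleftrightarrow> [v = u + d] (mod n)" for u v d :: int
    by blast
  ultimately show ?thesis
    unfolding circulant_def by (auto simp: doubleton_eq_iff)
qed

lemma circulant_closed_nbhd: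
  assumes "u \<in> {0..<n}"
  shows "closed_nbhd (circulant n D) u =
    {u} \<union> (\<Union>d\<in>D. {(u + d) mod n, (u - d) mod n})"
  using assms unfolding closed_nbhd_def circulant_edge_iff
  by (auto simp: cong_def)

lemma simple_graph_circulant:
  assumes "\<And>d. d \<in> D \<Longrightarrow> 0 < d \<and> 2 * d \<le> n"
  shows "simple_graph (circulant n D)"
proof -
  have "u \<noteq> v" if "u \<in> {0..<n}" "d \<in> D" "[v = u + d] (mod n) \<or> [v = u - d] (mod n)" for u v d
  proof
    assume "u = v"
    with that(3) have "n dvd d"
      by (auto simp: cong_iff_dvd_diff)
    moreover have "0 < d" "2 * d \<le> n" using assms[OF that(2)] by auto
    ultimately show False using zdvd_imp_le[of n d] by linarith
  qed
  then show ?thesis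
    unfolding simple_graph_def circulant_def by (auto simp: card_2_iff) metis+
qed

end

theory Submission
  imports Defs
begin

text \<open>
  The map \<open>(i, j) \<mapsto> i + d j\<close> makes the infinite king grid a covering of \<open>C\<^sub>n(1, d - 1, d, d + 1)\<close>, injective
  on balls of radius 2 since \<open>n > 4 d + 4\<close>, so codes in the circulant graph can be studied in the king grid.

  Lower bound. Let \<open>K\<close> be the size of a locating-dominating code and give each vertex \<open>u\<close> the
  charge \<open>|I(u)| - 2\<close>; the total charge is \<open>9 K - 2 n\<close>. The negative charges are \<open>-1\<close>, at isolated
  codewords and at non-codewords \<open>u\<close> with \<open>|I(u)| = 1\<close>, and each codeword sees at most one of the
  latter. So the total is at least \<open>-K\<close>, that is \<open>n \<le> 5 K\<close>, provided that the surplus of the vertices with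
  \<open>|I(u)| \<ge> 3\<close> can be distributed such that each isolated codeword seeing such a non-codeword
  receives a unit. In the 5 by 5 square around the codeword this is a finite propositional statement.

  The vertices congruent to 0 or 4 modulo 10 attain this bound. For the second part, an identifying
  code of density 2/9 of the king grid is wrapped around the circulant graph, with a seam of
  bounded width that is filled with codewords.
\<close>

subsection \<open>Discharging in the king grid\<close>

definition king_near :: "int \<Rightarrow> int \<Rightarrow> int \<Rightarrow> int \<Rightarrow> bool" where
  "king_near i j a b \<longleftrightarrow> \<bar>i - a\<bar> \<le> 1 \<and> \<bar>j - b\<bar> \<le> 1"

text \<open>Expresses that the \<open>I\<close>-sets of two grid vertices differ, for the code given
  by the predicate \<open>V\<close>.\<close>

definition king_separated :: "(int \<Rightarrow> int \<Rightarrow> bool) \<Rightarrow> int \<Rightarrow> int \<Rightarrow> int \<Rightarrow> int \<Rightarrow> bool" where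
  "king_separated V a b a' b' \<longleftrightarrow> (\<exists>i j. V i j \<and> king_near i j a b \<noteq> king_near i j a' b')"

text \<open>The size of the \<open>I\<close>-set of the origin; other vertices are reached by
  translating \<open>W\<close>.\<close>

definition king_count :: "(int \<Rightarrow> int \<Rightarrow> bool) \<Rightarrow> int" where
  "king_count W = (\<Sum>i\<in>{-1,0,1}. \<Sum>j\<in>{-1,0,1}. of_bool (W i j))"

lemma abs_le_1_iff: "a \<in> {-1,0,1} \<longleftrightarrow> \<bar>a\<bar> \<le> (1::int)"
  by auto

lemma king_count_eq_1D:
  assumes "king_count W = 1" "W i j" "W i' j'"
    and "i \<in> {-1,0,1}" "j \<in> {-1,0,1}" "i' \<in> {-1,0,1}" "j' \<in> {-1,0,1}"
  shows "(i, j) = (i', j')"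
proof (rule ccontr)
  assume ne: "(i, j) \<noteq> (i', j')"
  have "(\<Sum>(i, j)\<in>{(i, j), (i', j')}. of_bool (W i j) :: int) \<le>
      (\<Sum>(i, j)\<in>{-1,0,1} \<times> {-1,0,1}. of_bool (W i j))"
  proof (rule sum_mono2)
    show "{(i, j), (i', j')} \<subseteq> {-1,0,1} \<times> {-1,0,1}" using assms(4-7) by blast
  qed auto
  also have "\<dots> = king_count W"
    unfolding king_count_def sum.cartesian_product ..
  finally show False using assms(1-3) ne by auto
qed

text \<open>A separating codeword lies next to one of the two vertices, hence in the 5 by 5 square.
  This makes separation a finite disjunction.\<close>

lemma king_separated_bounded:
  assumes "king_separated V a b a' b'"
    and "a \<in> {-1,0,1}" "b \<in> {-1,0,1}" "a' \<in> {-1,0,1}" "b' \<in> {-1,0,1}"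
  shows "\<exists>i\<in>{-2,-1,0,1,2}. \<exists>j\<in>{-2,-1,0,1,2}. V i j \<and> king_near i j a b \<noteq> king_near i j a' b'"
proof -
  obtain i j where ij: "V i j" "king_near i j a b \<noteq> king_near i j a' b'"
    using assms(1) unfolding king_separated_def by blast
  then have "king_near i j a b \<or> king_near i j a' b'" by blast
  moreover have "\<bar>a\<bar> \<le> 1" "\<bar>b\<bar> \<le> 1" "\<bar>a'\<bar> \<le> 1" "\<bar>b'\<bar> \<le> 1" using assms(2-5) by auto
  ultimately have "\<bar>i\<bar> \<le> 2" "\<bar>j\<bar> \<le> 2" unfolding king_near_def by linarith+
  then have "i \<in> {-2,-1,0,1,2}" "j \<in> {-2,-1,0,1,2}" by auto
  with ij show ?thesis by blast
qed

text \<open>\<open>gift W i j\<close> is twice the charge that the vertex at the origin passes to the codeword at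
  \<open>(i, j)\<close>. A non-codeword with \<open>m\<close> codewords around it has a surplus of \<open>m - 2\<close>, which goes to
  those of them that are not adjacent to another one: a full unit each if some two of the others are
  adjacent. Otherwise only corners receive something, namely half a unit, and this happens for the
  ends of three corners, for all of four corners, and for the two corners opposite to a side.\<close>

definition gift :: "(int \<Rightarrow> int \<Rightarrow> bool) \<Rightarrow> int \<Rightarrow> int \<Rightarrow> int" where
  "gift W i j =
    (if W 0 0 \<or> \<not> W i j then 0
     else if i \<noteq> 0 \<and> j \<noteq> 0 then
       (if W i 0 \<or> W 0 j then 0
        else if W (-i) j \<and> W (-i) 0 \<or> W (-i) 0 \<and> W (-i) (-j) \<or> W (-i) (-j) \<and> W 0 (-j)
          \<or> W 0 (-j) \<and> W i (-j) \<or> W (-i) 0 \<and> W 0 (-j) then 2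
        else if W (-i) (-j) \<and> (W (-i) j \<or> W i (-j)) \<or> W (-i) j \<and> W 0 (-j) \<or> W i (-j) \<and> W (-i) 0
          then 1 else 0)
     else if W (i + j) (j + i) \<or> W (i - j) (j - i) \<or> W j i \<or> W (-j) (-i) then 0
     else if W (-i) (-j) \<and> (W (j - i) (i - j) \<or> W (- i - j) (- j - i)) then 2 else 0)"

lemma gift_nonneg: "0 \<le> gift W i j"
  by (simp add: gift_def)

text \<open>No vertex passes on more than its surplus. Gifts are doubled, hence the factor 2; the
  last term cancels the charge -1 of a vertex seeing one codeword, which gives nothing. Codewords
  give nothing either, so only the eight neighbours of a non-codeword need a case split.\<close>

lemma sum_gift_le:
  assumes "1 \<le> king_count W"
  shows "(\<Sum>i\<in>{-1,0,1}. \<Sum>j\<in>{-1,0,1}. gift W i j)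
    \<le> 2 * (king_count W - 2) + 2 * of_bool (king_count W = 1)"
proof (cases "W 0 0")
  case True
  then have "gift W i j = 0" for i j by (simp add: gift_def)
  then show ?thesis using assms by auto
next
  case False
  show ?thesis using assms False unfolding king_count_def gift_def
    by (simp split del: if_split)
      (cases "W 1 1"; cases "W 1 0"; cases "W 0 1"; cases "W (-1) 0"; cases "W 0 (-1)";
       simp split del: if_split;
       cases "W 1 (-1)"; cases "W (-1) 1"; cases "W (-1) (-1)"; simp split del: if_split)
qed

text \<open>The vertex \<open>(-i, -j)\<close> sees the origin in direction \<open>(i, j)\<close>,
  so the sum is what the origin receives; 2 stands for one unit. Since \<open>(a, b)\<close> sees
  the origin only, every other neighbour of the origin must see a second codeword, on the border of
  the 5 by 5 square. These codewords create enough surplus around the origin.\<close>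

lemma sum_gift_isolated:
  assumes code: "V 0 0"
    and isolated: "king_count V = 1"
    and sep: "\<And>a b a' b'. \<lbrakk>a \<in> {-1,0,1}; b \<in> {-1,0,1}; a' \<in> {-1,0,1}; b' \<in> {-1,0,1};
      (a, b) \<noteq> (a', b'); \<not> V a b; \<not> V a' b'\<rbrakk> \<Longrightarrow> king_separated V a b a' b'"
    and ab: "a \<in> {-1,0,1}" "b \<in> {-1,0,1}" "\<not> V a b"
    and only: "\<And>i j. V i j \<Longrightarrow> king_near i j a b \<Longrightarrow> (i, j) = (0, 0)"
  shows "2 \<le> (\<Sum>i\<in>{-1,0,1}. \<Sum>j\<in>{-1,0,1}. gift (\<lambda>a b. V (a - i) (b - j)) i j)"
proof -
  have inner: "\<not> V 1 0" "\<not> V 0 1" "\<not> V (-1) 0" "\<not> V 0 (-1)"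
    "\<not> V 1 1" "\<not> V 1 (-1)" "\<not> V (-1) 1" "\<not> V (-1) (-1)"
    using king_count_eq_1D[OF isolated code] by force+
  have sep': "\<exists>i\<in>{-2,-1,0,1,2}. \<exists>j\<in>{-2,-1,0,1,2}. V i j \<and> king_near i j a b \<noteq> king_near i j a' b'"
    if "a \<in> {-1,0,1}" "b \<in> {-1,0,1}" "a' \<in> {-1,0,1}" "b' \<in> {-1,0,1}" "(a, b) \<noteq> (a', b')"
      "\<not> V a b" "\<not> V a' b'" for a b a' b'
    using king_separated_bounded[OF sep[OF that]] that(1-4) by blast
  \<comment> \<open>It is enough to separate each side from the two adjacent corners and from the opposite side.\<close>
  note seps = sep'[of 1 0 1 1] sep'[of 1 0 1 "-1"] sep'[of "-1" 0 "-1" 1] sep'[of "-1" 0 "-1" "-1"]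
    sep'[of 0 1 1 1] sep'[of 0 1 "-1" 1] sep'[of 0 "-1" 1 "-1"] sep'[of 0 "-1" "-1" "-1"]
    sep'[of 1 0 "-1" 0] sep'[of 0 1 0 "-1"]
  \<comment> \<open>With \<open>a\<close> and \<open>b\<close> bound by a finite existential, the
    goal involves only the truth values of \<open>V\<close> on the 25 cells.\<close>
  have single: "\<exists>a\<in>{-1,0,1}. \<exists>b\<in>{-1,0,1}. \<not> V a b \<and>
      (\<forall>i\<in>{-2,-1,0,1,2}. \<forall>j\<in>{-2,-1,0,1,2}. V i j \<longrightarrow> king_near i j a b \<longrightarrow> (i, j) = (0, 0))"
    by (intro bexI[of _ a] bexI[of _ b] conjI ballI impI only ab)
  show ?thesis unfolding gift_def
    apply (simp add: code inner split del: if_split cong del: if_cong)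
    using seps[unfolded king_near_def, simplified] single[unfolded king_near_def, simplified] code inner
    by (smt (verit))
qed

text \<open>A codeword has at most one private non-codeword, so the left side is positive only if
  the codeword is also isolated. That case is \<open>sum_gift_isolated\<close>; elsewhere it is
  enough that gifts are nonnegative.\<close>

lemma sum_gift_ge:
  assumes code: "V 0 0"
    and sep: "\<And>a b a' b'. \<lbrakk>a \<in> {-1,0,1}; b \<in> {-1,0,1}; a' \<in> {-1,0,1}; b' \<in> {-1,0,1};
      (a, b) \<noteq> (a', b'); \<not> V a b; \<not> V a' b'\<rbrakk> \<Longrightarrow> king_separated V a b a' b'"
  defines "single \<equiv> \<lambda>a b. \<not> V a b \<and> king_count (\<lambda>i j. V (a + i) (b + j)) = 1"
  shows "2 * (of_bool (king_count V = 1) + (\<Sum>a\<in>{-1,0,1}. \<Sum>b\<in>{-1,0,1}. of_bool (single a b)) - 1)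
    \<le> (\<Sum>i\<in>{-1,0,1}. \<Sum>j\<in>{-1,0,1}. gift (\<lambda>a b. V (a - i) (b - j)) i j)"
    (is "2 * (_ + ?S - 1) \<le> ?T")
proof -
  have unique: "(i, j) = (0, 0)"
    if "single a b" "a \<in> {-1,0,1}" "b \<in> {-1,0,1}" "V i j" "king_near i j a b" for a b i j
  proof -
    have "\<bar>i - a\<bar> \<le> 1" "\<bar>j - b\<bar> \<le> 1" "\<bar>- a\<bar> \<le> 1" "\<bar>- b\<bar> \<le> 1"
      using that unfolding king_near_def abs_le_1_iff by auto
    then have "(i - a, j - b) = (- a, - b)"
      using that code unfolding abs_le_1_iff[symmetric] single_def
      by (intro king_count_eq_1D[of "\<lambda>i j. V (a + i) (b + j)"]) simp_all
    then show ?thesis by simp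
  qed
  \<comment> \<open>Two such vertices would both have the origin as their only codeword, and nothing
    would separate them.\<close>
  have no_two: "(a, b) = (a', b')"
    if h: "single a b" "single a' b'"
      "a \<in> {-1,0,1}" "b \<in> {-1,0,1}" "a' \<in> {-1,0,1}" "b' \<in> {-1,0,1}" for a b a' b'
  proof (rule ccontr)
    assume "(a, b) \<noteq> (a', b')"
    then obtain i j where ij: "V i j" "king_near i j a b \<noteq> king_near i j a' b'"
      using sep[of a b a' b'] h unfolding single_def king_separated_def by blast
    then have "(i, j) = (0, 0)" using unique[of a b i j] unique[of a' b' i j] h by blast
    moreover have "king_near 0 0 a b" "king_near 0 0 a' b'"
      using h unfolding king_near_def abs_le_1_iff by simp_all
    ultimately show False using ij by simp
  qed
  define S T where "S = ?S" and "T = ?T"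
  have T0: "0 \<le> T" unfolding T_def by (intro sum_nonneg gift_nonneg)
  have S_eq: "S = (\<Sum>p\<in>{-1,0,1} \<times> {-1,0,1}. of_bool (single (fst p) (snd p)))"
    unfolding S_def sum.cartesian_product case_prod_unfold ..
  have "2 * (of_bool (king_count V = 1) + S - 1) \<le> T"
  proof (cases "\<exists>p\<in>{-1,0,1} \<times> {-1,0,1}. single (fst p) (snd p)")
    case False
    then have "S = 0" unfolding S_eq by (intro sum.neutral ballI) (metis of_bool_eq(1))
    then show ?thesis using T0 by (cases "king_count V = 1"; simp)
  next
    case True
    then obtain p where p: "p \<in> {-1,0,1} \<times> {-1,0,1}" "single (fst p) (snd p)" by blast
    then have ab: "fst p \<in> {-1,0,1}" "snd p \<in> {-1,0,1}" by (metis mem_Times_iff)+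
    have other: "\<not> single (fst q) (snd q)" if "q \<in> {-1,0,1} \<times> {-1,0,1} - {p}" for q
    proof
      assume "single (fst q) (snd q)"
      moreover have "fst q \<in> {-1,0,1}" "snd q \<in> {-1,0,1}" using that by (metis DiffD1 mem_Times_iff)+
      ultimately have "(fst p, snd p) = (fst q, snd q)" using no_two p(2) ab by blast
      then show False using that by (metis DiffD2 prod.collapse singletonI)
    qed
    have "S = (\<Sum>q\<in>{p}. of_bool (single (fst q) (snd q)))"
      unfolding S_eq using p other by (intro sum.mono_neutral_right ballI) (simp_all only: of_bool_eq, blast+)
    then have S1: "S = 1" using p by simp
    show ?thesis
    proof (cases "king_count V = 1")
      case False
      then show ?thesis using T0 S1 by simp
    next
      case iso: True
      have "\<not> V (fst p) (snd p)" using p(2) by (simp add: single_def)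
      then have "2 \<le> T" unfolding T_def
        using sum_gift_isolated[OF code iso sep ab] unique[OF p(2) ab] by blast
      then show ?thesis using iso S1 by simp
    qed
  qed
  then show ?thesis unfolding S_def T_def .
qed

section \<open>Double counting of the charges over the residues modulo \<open>n\<close>\<close>

lemma sum_shift_mod:
  fixes f :: "int \<Rightarrow> int"
  assumes "0 < n" and "\<And>x. f (x mod n) = f x"
  shows "(\<Sum>x\<in>{0..<n}. f (x + t)) = (\<Sum>x\<in>{0..<n}. f x)"
proof (rule sum.reindex_bij_witness[where i = "\<lambda>x. (x - t) mod n" and j = "\<lambda>x. (x + t) mod n"])
  show "f ((x + t) mod n) = f (x + t)" for x by (rule assms(2))
qed (use assms(1) in \<open>auto simp: mod_simps\<close>)

lemma sum_swap3:
  "(\<Sum>x\<in>X. \<Sum>i\<in>A. \<Sum>j\<in>B. f x i j) = (\<Sum>i\<in>A. \<Sum>j\<in>B. \<Sum>x\<in>X. f x i j)"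
  by (subst sum.swap, intro sum.cong refl, subst sum.swap, rule refl)

lemma king_locating_dominating_bound:
  fixes c :: "int \<Rightarrow> bool" and n d :: int
  assumes n: "0 < n"
    and per: "\<And>x. c (x mod n) = c x"
    and dom: "\<And>x. 1 \<le> king_count (\<lambda>i j. c (x + i + d * j))"
    and sep: "\<And>x a b a' b'. \<lbrakk>a \<in> {-1,0,1}; b \<in> {-1,0,1}; a' \<in> {-1,0,1}; b' \<in> {-1,0,1};
      (a, b) \<noteq> (a', b'); \<not> c (x + a + d * b); \<not> c (x + a' + d * b')\<rbrakk>
      \<Longrightarrow> king_separated (\<lambda>i j. c (x + i + d * j)) a b a' b'"
  shows "n \<le> 5 * (\<Sum>x\<in>{0..<n}. of_bool (c x))"
proof -
  define W where "W x = (\<lambda>i j. c (x + i + d * j))" for x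
  define s where "s x = king_count (W x)" for x
  define g where "g x = (of_bool (\<not> c x \<and> s x = 1) :: int)" for x
  define K N1 G where "K = (\<Sum>x\<in>{0..<n}. of_bool (c x) :: int)"
    and "N1 = (\<Sum>x\<in>{0..<n}. of_bool (s x = 1) :: int)"
    and "G = (\<Sum>x\<in>{0..<n}. \<Sum>i\<in>{-1,0,1}. \<Sum>j\<in>{-1,0,1}. gift (W x) i j)"
  have c_mod: "c (x mod n + t) = c (x + t)" for x t
    using per[of "x mod n + t"] per[of "x + t"] by (simp add: mod_simps)
  have W_mod: "W (x mod n) = W x" for x
    unfolding W_def using c_mod[of x] by (simp add: add.assoc)
  have s_mod: "s (x mod n) = s x" for x by (simp add: s_def W_mod)
  have g_mod: "g (x mod n) = g x" for x by (simp add: g_def s_mod per)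
  have g_mod': "g (x mod n + t) = g (x + t)" for x t
    using g_mod[of "x mod n + t"] g_mod[of "x + t"] by (simp add: mod_simps)

  \<comment> \<open>Every codeword is seen by nine vertices.\<close>
  have "(\<Sum>x\<in>{0..<n}. s x) = (\<Sum>i\<in>{-1,0,1}. \<Sum>j\<in>{-1,0,1}. \<Sum>x\<in>{0..<n}. of_bool (W x i j))"
    unfolding s_def king_count_def by (rule sum_swap3)
  also have "\<dots> = (\<Sum>i\<in>{-1,0,1::int}. \<Sum>j\<in>{-1,0,1::int}. K)"
  proof (intro sum.cong refl)
    fix i j
    show "(\<Sum>x\<in>{0..<n}. of_bool (W x i j)) = K"
      using sum_shift_mod[OF n, of "\<lambda>x. of_bool (c x)" "i + d * j"] per
      by (simp add: W_def K_def add.assoc)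
  qed
  finally have sum_s: "(\<Sum>x\<in>{0..<n}. s x) = 9 * K" by simp

  \<comment> \<open>Gifts summed by receiver equal gifts summed by giver: the giver is
    \<open>x\<close> translated by \<open>- i - d * j\<close>.\<close>
  have "(\<Sum>x\<in>{0..<n}. \<Sum>i\<in>{-1,0,1}. \<Sum>j\<in>{-1,0,1}. gift (\<lambda>a b. W x (a - i) (b - j)) i j)
      = (\<Sum>i\<in>{-1,0,1}. \<Sum>j\<in>{-1,0,1}. \<Sum>x\<in>{0..<n}. gift (\<lambda>a b. W x (a - i) (b - j)) i j)"
    by (rule sum_swap3)
  also have "\<dots> = (\<Sum>i\<in>{-1,0,1}. \<Sum>j\<in>{-1,0,1}. \<Sum>x\<in>{0..<n}. gift (W x) i j)"
  proof (rule sum.cong[OF refl], rule sum.cong[OF refl])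
    fix i j
    have "(\<lambda>a b. W x (a - i) (b - j)) = W (x + (- i - d * j))" for x
      by (simp add: W_def algebra_simps)
    then show "(\<Sum>x\<in>{0..<n}. gift (\<lambda>a b. W x (a - i) (b - j)) i j) = (\<Sum>x\<in>{0..<n}. gift (W x) i j)"
      using sum_shift_mod[OF n, of "\<lambda>x. gift (W x) i j" "- i - d * j"] W_mod by simp
  qed
  also have "\<dots> = G" unfolding G_def by (rule sum_swap3[symmetric])
  finally have received:
    "(\<Sum>x\<in>{0..<n}. \<Sum>i\<in>{-1,0,1}. \<Sum>j\<in>{-1,0,1}. gift (\<lambda>a b. W x (a - i) (b - j)) i j) = G" .

  \<comment> \<open>Pairs of a codeword and a private non-codeword are counted from the side of the
    non-codeword, where \<open>s x = 1\<close> whenever \<open>g x\<close> is nonzero.\<close>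
  have "(\<Sum>x\<in>{0..<n}. of_bool (c x) * (\<Sum>a\<in>{-1,0,1}. \<Sum>b\<in>{-1,0,1}. g (x + a + d * b)))
      = (\<Sum>a\<in>{-1,0,1}. \<Sum>b\<in>{-1,0,1}. \<Sum>x\<in>{0..<n}. of_bool (c x) * g (x + a + d * b))"
    unfolding sum_distrib_left by (rule sum_swap3)
  also have "\<dots> = (\<Sum>a\<in>{-1,0,1}. \<Sum>b\<in>{-1,0,1}. \<Sum>x\<in>{0..<n}. of_bool (c (x - a - d * b)) * g x)"
  proof (rule sum.cong[OF refl], rule sum.cong[OF refl])
    fix a b
    define h where "h x = of_bool (c x) * g (x + (a + d * b))" for x
    have "h (x mod n) = h x" for x by (simp add: h_def per g_mod')
    then have "(\<Sum>x\<in>{0..<n}. h x) = (\<Sum>x\<in>{0..<n}. h (x + (- a - d * b)))"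
      by (rule sum_shift_mod[OF n, symmetric])
    moreover have "x + (- a - d * b) + (a + d * b) = x" "x + (- a - d * b) = x - a - d * b" for x by auto
    ultimately show "(\<Sum>x\<in>{0..<n}. of_bool (c x) * g (x + a + d * b))
        = (\<Sum>x\<in>{0..<n}. of_bool (c (x - a - d * b)) * g x)"
      by (simp only: h_def add.assoc[symmetric])
  qed
  also have "\<dots> = (\<Sum>x\<in>{0..<n}. \<Sum>a\<in>{-1,0,1}. \<Sum>b\<in>{-1,0,1}. of_bool (c (x - a - d * b)) * g x)"
    by (rule sum_swap3[symmetric])
  also have "\<dots> = (\<Sum>x\<in>{0..<n}. s x * g x)"
  proof (rule sum.cong[OF refl])
    fix x
    have "(\<Sum>a\<in>{-1,0,1}. \<Sum>b\<in>{-1,0,1}. of_bool (c (x - a - d * b))) = s x"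
      by (simp add: s_def king_count_def W_def del: sum_of_bool_eq)
    then show "(\<Sum>a\<in>{-1,0,1}. \<Sum>b\<in>{-1,0,1}. of_bool (c (x - a - d * b)) * g x) = s x * g x"
      unfolding sum_distrib_right[symmetric] by simp
  qed
  also have "\<dots> = (\<Sum>x\<in>{0..<n}. g x)"
    by (intro sum.cong refl) (simp add: g_def)
  finally have singles:
    "(\<Sum>x\<in>{0..<n}. of_bool (c x) * (\<Sum>a\<in>{-1,0,1}. \<Sum>b\<in>{-1,0,1}. g (x + a + d * b))) = (\<Sum>x\<in>{0..<n}. g x)" .

  \<comment> \<open>The vertices of charge -1 are the isolated codewords and the non-codewords
    counted by \<open>g\<close>; the latter are now charged to their codewords.\<close>
  have "of_bool (s x = 1) = of_bool (c x) * of_bool (s x = 1) + g x" for x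
    by (simp add: g_def)
  then have "N1 = (\<Sum>x\<in>{0..<n}. of_bool (c x) * of_bool (s x = 1)) + (\<Sum>x\<in>{0..<n}. g x)"
    unfolding N1_def sum.distrib[symmetric] by (intro sum.cong refl)
  then have "2 * (N1 - K) = 2 * ((\<Sum>x\<in>{0..<n}. of_bool (c x) * of_bool (s x = 1)) + (\<Sum>x\<in>{0..<n}. g x) - K)"
    by (simp only:)
  also have "\<dots> = (\<Sum>x\<in>{0..<n}. 2 * (of_bool (c x) * (of_bool (s x = 1)
      + (\<Sum>a\<in>{-1,0,1}. \<Sum>b\<in>{-1,0,1}. g (x + a + d * b)) - 1)))"
    unfolding singles[symmetric] K_def sum_distrib_left[symmetric] sum.distrib[symmetric] sum_subtractf[symmetric]
    by (simp only: distrib_left right_diff_distrib mult_1_right)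
  also have "\<dots> \<le> (\<Sum>x\<in>{0..<n}. \<Sum>i\<in>{-1,0,1}. \<Sum>j\<in>{-1,0,1}. gift (\<lambda>a b. W x (a - i) (b - j)) i j)"
  proof (rule sum_mono)
    fix x
    show "2 * (of_bool (c x) * (of_bool (s x = 1) + (\<Sum>a\<in>{-1,0,1}. \<Sum>b\<in>{-1,0,1}. g (x + a + d * b)) - 1))
        \<le> (\<Sum>i\<in>{-1,0,1}. \<Sum>j\<in>{-1,0,1}. gift (\<lambda>a b. W x (a - i) (b - j)) i j)"
    proof (cases "c x")
      case True
      have eq: "g (x + a + d * b) = of_bool (\<not> W x a b \<and> king_count (\<lambda>i j. W x (a + i) (b + j)) = 1)" for a b
      proof -
        have "(\<lambda>i j. W x (a + i) (b + j)) = W (x + a + d * b)"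
          by (simp add: W_def algebra_simps)
        then show ?thesis by (simp add: g_def s_def) (simp add: W_def)
      qed
      have "W x 0 0" using True by (simp add: W_def)
      then show ?thesis
        using sum_gift_ge[of "W x"] sep[of _ _ _ _ x] True unfolding eq s_def W_def by simp
    next
      case False
      then show ?thesis by (simp add: sum_nonneg gift_nonneg)
    qed
  qed
  also have "\<dots> = G" by (rule received)
  \<comment> \<open>Together, \<open>2 * (N1 - K) \<le> G \<le> 18 * K - 4 * n + 2 * N1\<close>; the
    terms in \<open>N1\<close> cancel.\<close>
  also have "G \<le> (\<Sum>x\<in>{0..<n}. 2 * (s x - 2) + 2 * of_bool (s x = 1))"
    unfolding G_def s_def using dom by (intro sum_mono sum_gift_le) (simp add: W_def)
  also have "\<dots> = 2 * (\<Sum>x\<in>{0..<n}. s x) - 4 * n + 2 * N1"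
    unfolding N1_def using n by (simp add: sum.distrib sum_subtractf sum_distrib_left right_diff_distrib)
  finally show ?thesis unfolding sum_s K_def[symmetric] by simp
qed

subsection \<open>The covering of the circulant graph\<close>

text \<open>The code seen from \<open>x\<close> after lifting along the covering of the circulant graph by the king grid
  that sends \<open>(i, j)\<close> to \<open>i + d * j\<close>.\<close>

definition window :: "int \<Rightarrow> int \<Rightarrow> int set \<Rightarrow> int \<Rightarrow> int \<Rightarrow> int \<Rightarrow> bool" where
  "window n d C x i j \<longleftrightarrow> (x + i + d * j) mod n \<in> C"

lemma mod_shift: "(x mod n + i + d * j) mod n = (x + i + d * j) mod n" for x :: int
  by (metis add.assoc mod_add_left_eq)

lemma window_mod: "window n d C (x mod n) = window n d C x"
  by (intro ext) (simp only: window_def mod_shift)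

lemma window_shift: "window n d C (x + a + d * b) i j = window n d C x (a + i) (b + j)"
  by (simp add: window_def algebra_simps)

lemma king_separated_shift:
  "king_separated (\<lambda>i j. V (a + i) (b + j)) 0 0 (a' - a) (b' - b) = king_separated V a b a' b'"
proof
  assume "king_separated (\<lambda>i j. V (a + i) (b + j)) 0 0 (a' - a) (b' - b)"
  then obtain i j where "V (a + i) (b + j)" "king_near i j 0 0 \<noteq> king_near i j (a' - a) (b' - b)"
    unfolding king_separated_def by blast
  then show "king_separated V a b a' b'"
    unfolding king_separated_def
    by (intro exI[of _ "a + i"] exI[of _ "b + j"]) (auto simp: king_near_def algebra_simps)
next
  assume "king_separated V a b a' b'"
  then obtain i j where "V i j" "king_near i j a b \<noteq> king_near i j a' b'"
    unfolding king_separated_def by blast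
  then show "king_separated (\<lambda>i j. V (a + i) (b + j)) 0 0 (a' - a) (b' - b)"
    unfolding king_separated_def
    by (intro exI[of _ "i - a"] exI[of _ "j - b"]) (auto simp: king_near_def algebra_simps)
qed

text \<open>The nine values of \<open>i + d * j\<close> are 0 and plus or minus the four distances,
  so king moves project onto the edges.\<close>

lemma closed_nbhd_king_circulant:
  assumes "u \<in> {0..<n}"
  shows "closed_nbhd (circulant n {1, d - 1, d, d + 1}) u
    = (\<lambda>(i, j). (u + i + d * j) mod n) ` ({-1,0,1} \<times> {-1,0,1})"
  unfolding circulant_closed_nbhd[OF assms] using assms
  by (auto simp: algebra_simps)

lemma mem_I_set_iff:
  assumes "u \<in> {0..<n}"
  shows "y \<in> I_set (circulant n {1, d - 1, d, d + 1}) C u \<longleftrightarrow>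
    (\<exists>i j. king_near i j 0 0 \<and> window n d C u i j \<and> y = (u + i + d * j) mod n)"
proof -
  have "y \<in> (\<lambda>(i, j). f i j) ` (A \<times> B) \<inter> C \<longleftrightarrow> (\<exists>i j. (i \<in> A \<and> j \<in> B) \<and> f i j \<in> C \<and> y = f i j)"
    for A B :: "int set" and f by auto
  then show ?thesis
    unfolding I_set_def closed_nbhd_king_circulant[OF assms] window_def king_near_def
      diff_0_right abs_le_1_iff[symmetric] .
qed

text \<open>Injectivity of the covering on balls of radius 2, where coordinates differ by at most 4:
  the combination is smaller than \<open>n\<close> in absolute value, hence 0, and then
  \<open>5 \<le> d\<close> exceeds the size of \<open>a\<close>.\<close>

lemma small_combination_eq_0:
  fixes n d a b :: int
  assumes "5 \<le> d" "4 * d + 5 \<le> n" "\<bar>a\<bar> \<le> 4" "\<bar>b\<bar> \<le> 4" "n dvd a + d * b"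
  shows "a = 0 \<and> b = 0"
proof -
  have "\<bar>d * b\<bar> \<le> d * 4" unfolding abs_mult using assms by (intro mult_mono) auto
  then have "\<bar>a + d * b\<bar> < n" using assms by linarith
  then have z: "a + d * b = 0" using assms(5) zdvd_imp_le[of n "\<bar>a + d * b\<bar>"] by force
  have "b = 0"
  proof (rule ccontr)
    assume "b \<noteq> 0"
    then have "5 * 1 \<le> \<bar>d\<bar> * \<bar>b\<bar>" using assms(1) by (intro mult_mono) auto
    then show False using z assms(3) unfolding abs_mult[symmetric] by linarith
  qed
  then show ?thesis using z by simp
qed

text \<open>Separation may be tested in the lift, because the covering identifies no two distinct
  points of the two neighbourhoods involved.\<close>

lemma I_set_eq_iff_not_separated:
  assumes nd: "5 \<le> d" "4 * d + 5 \<le> n" and u: "u \<in> {0..<n}"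
    and ab: "\<bar>a\<bar> \<le> 2" "\<bar>b\<bar> \<le> 2" and v: "v = (u + a + d * b) mod n"
  shows "I_set (circulant n {1, d - 1, d, d + 1}) C u = I_set (circulant n {1, d - 1, d, d + 1}) C v
    \<longleftrightarrow> \<not> king_separated (window n d C u) 0 0 a b"
proof -
  let ?I = "I_set (circulant n {1, d - 1, d, d + 1}) C"
  have v': "v \<in> {0..<n}" using v nd by simp
  have Iv: "y \<in> ?I v \<longleftrightarrow> (\<exists>i j. king_near i j a b \<and> window n d C u i j \<and> y = (u + i + d * j) mod n)" for y
  proof -
    have "y \<in> ?I v \<longleftrightarrow> (\<exists>i j. king_near i j 0 0 \<and> window n d C u (a + i) (b + j)
        \<and> y = (u + (a + i) + d * (b + j)) mod n)"
      unfolding mem_I_set_iff[OF v'] unfolding v window_mod window_shift mod_shift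
      by (simp add: algebra_simps)
    also have "\<dots> \<longleftrightarrow> (\<exists>i j. king_near i j a b \<and> window n d C u i j \<and> y = (u + i + d * j) mod n)"
      (is "?L \<longleftrightarrow> ?R")
    proof
      assume ?L
      then obtain i j where "king_near i j 0 0 \<and> window n d C u (a + i) (b + j)
        \<and> y = (u + (a + i) + d * (b + j)) mod n" by blast
      then show ?R by (intro exI[of _ "a + i"] exI[of _ "b + j"]) (simp add: king_near_def)
    next
      assume ?R
      then obtain i j where "king_near i j a b \<and> window n d C u i j \<and> y = (u + i + d * j) mod n" by blast
      then show ?L by (intro exI[of _ "i - a"] exI[of _ "j - b"]) (simp add: king_near_def)
    qed
    finally show ?thesis .
  qed
  \<comment> \<open>One point has coordinates in -1..1, the other in -3..3, so they differ by at
    most 4.\<close>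
  have inj: "i = i' \<and> j = j'"
    if "king_near i j 0 0" "king_near i' j' a b" "(u + i + d * j) mod n = (u + i' + d * j') mod n" for i j i' j'
  proof -
    have "n dvd (u + i + d * j) - (u + i' + d * j')" using that(3) by (simp add: mod_eq_dvd_iff)
    then have "n dvd (i - i') + d * (j - j')" by (simp add: algebra_simps)
    moreover have "\<bar>i - i'\<bar> \<le> 4" "\<bar>j - j'\<bar> \<le> 4"
      using that(1,2) ab unfolding king_near_def by linarith+
    ultimately show ?thesis using small_combination_eq_0[OF nd] by force
  qed
  show ?thesis
  proof
    assume eq: "?I u = ?I v"
    show "\<not> king_separated (window n d C u) 0 0 a b"
    proof
      assume "king_separated (window n d C u) 0 0 a b"
      then obtain i j where ij: "window n d C u i j" "king_near i j 0 0 \<noteq> king_near i j a b"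
        unfolding king_separated_def by blast
      then have "(u + i + d * j) mod n \<in> ?I u \<or> (u + i + d * j) mod n \<in> ?I v"
        unfolding mem_I_set_iff[OF u] Iv by blast
      then have "(u + i + d * j) mod n \<in> ?I u" "(u + i + d * j) mod n \<in> ?I v" using eq by auto
      then obtain i1 j1 i2 j2 where
        "king_near i1 j1 0 0" "(u + i + d * j) mod n = (u + i1 + d * j1) mod n"
        "king_near i2 j2 a b" "(u + i + d * j) mod n = (u + i2 + d * j2) mod n"
        unfolding mem_I_set_iff[OF u] Iv by blast
      then show False using ij(2) inj by metis
    qed
  next
    assume "\<not> king_separated (window n d C u) 0 0 a b"
    then have "king_near i j 0 0 = king_near i j a b" if "window n d C u i j" for i j
      using that unfolding king_separated_def by blast
    then show "?I u = ?I v"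
      unfolding set_eq_iff mem_I_set_iff[OF u] Iv by blast
  qed
qed

text \<open>Vertices with a common codeword are two king moves apart, so only offsets up to 2 have
  to be separated.\<close>

lemma I_set_eq_imp_near:
  assumes u: "u \<in> {0..<n}" and v: "v \<in> {0..<n}" and "u \<noteq> v"
    and eq: "I_set (circulant n {1, d - 1, d, d + 1}) C u = I_set (circulant n {1, d - 1, d, d + 1}) C v"
    and ne: "I_set (circulant n {1, d - 1, d, d + 1}) C u \<noteq> {}"
  obtains a b where "\<bar>a\<bar> \<le> 2" "\<bar>b\<bar> \<le> 2" "(a, b) \<noteq> (0, 0)" "v = (u + a + d * b) mod n"
proof -
  obtain y where y: "y \<in> I_set (circulant n {1, d - 1, d, d + 1}) C u"
    "y \<in> I_set (circulant n {1, d - 1, d, d + 1}) C v" using eq ne by auto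
  then obtain i j i' j' where near: "king_near i j 0 0" "king_near i' j' 0 0"
    and eq': "(u + i + d * j) mod n = (v + i' + d * j') mod n"
    unfolding mem_I_set_iff[OF u] mem_I_set_iff[OF v] by blast
  from eq' have "(u + i + d * j - (i' + d * j')) mod n = (v + i' + d * j' - (i' + d * j')) mod n"
    by (rule mod_diff_cong) simp
  then have veq: "v = (u + (i - i') + d * (j - j')) mod n"
    using v by (simp add: algebra_simps)
  moreover have "\<bar>i - i'\<bar> \<le> 2" "\<bar>j - j'\<bar> \<le> 2" using near unfolding king_near_def by linarith+
  moreover have "(i - i', j - j') \<noteq> (0, 0)"
  proof
    assume "(i - i', j - j') = (0, 0)"
    then have "v = u" using veq u by simp
    then show False using \<open>u \<noteq> v\<close> by simp
  qed
  ultimately show thesis using that by blast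
qed

section \<open>Codes in the circulant graph described by windows\<close>

lemma dominating_king_circulant_iff:
  assumes "0 < n" "C \<subseteq> {0..<n}"
  shows "dominating_code (circulant n {1, d - 1, d, d + 1}) C \<longleftrightarrow>
    (\<forall>x. \<exists>i j. king_near i j 0 0 \<and> window n d C x i j)"
proof -
  have dom: "I_set (circulant n {1, d - 1, d, d + 1}) C (x mod n) \<noteq> {} \<longleftrightarrow>
      (\<exists>i j. king_near i j 0 0 \<and> window n d C x i j)" for x
  proof -
    have "x mod n \<in> {0..<n}" using assms(1) by simp
    from mem_I_set_iff[OF this] show ?thesis unfolding window_mod by blast
  qed
  \<comment> \<open>A window depends only on its centre modulo \<open>n\<close>, so all integers may
    serve as centres.\<close>
  have "(\<forall>u\<in>{0..<n}. I_set (circulant n {1, d - 1, d, d + 1}) C u \<noteq> {}) \<longleftrightarrow>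
      (\<forall>x. I_set (circulant n {1, d - 1, d, d + 1}) C (x mod n) \<noteq> {})"
    using assms(1) by (metis atLeastLessThan_iff mod_pos_pos_trivial pos_mod_bound pos_mod_sign)
  moreover have "C \<noteq> {}" if "\<forall>x. \<exists>i j. king_near i j 0 0 \<and> window n d C x i j"
    using that unfolding window_def by blast
  ultimately show ?thesis
    unfolding dominating_code_def is_code_def dom using assms(2) by (auto simp: circulant_def)
qed

lemma identifying_king_circulantI:
  assumes nd: "5 \<le> d" "4 * d + 5 \<le> n" and C: "C \<subseteq> {0..<n}"
    and dom: "\<And>x. \<exists>i j. king_near i j 0 0 \<and> window n d C x i j"
    and sep: "\<And>x a b. \<bar>a\<bar> \<le> 2 \<Longrightarrow> \<bar>b\<bar> \<le> 2 \<Longrightarrow> (a, b) \<noteq> (0, 0)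
      \<Longrightarrow> king_separated (window n d C x) 0 0 a b"
  shows "identifying_code (circulant n {1, d - 1, d, d + 1}) C" (is "identifying_code ?G C")
proof -
  have verts: "verts ?G = {0..<n}" by (simp add: circulant_def)
  have D: "dominating_code ?G C" using dominating_king_circulant_iff[of n C d] nd C dom by auto
  have False
    if u: "u \<in> {0..<n}" and v: "v \<in> {0..<n}" and h: "u \<noteq> v" "I_set ?G C u = I_set ?G C v" for u v
  proof -
    have "I_set ?G C u \<noteq> {}" using D u unfolding dominating_code_def verts by blast
    then obtain a b where ab: "\<bar>a\<bar> \<le> 2" "\<bar>b\<bar> \<le> 2" "(a, b) \<noteq> (0, 0)" "v = (u + a + d * b) mod n"
      using I_set_eq_imp_near[OF u v h] by blast
    then show False using sep I_set_eq_iff_not_separated[OF nd u ab(1,2,4)] h(2) by blast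
  qed
  then show ?thesis unfolding identifying_code_def verts using D by blast
qed

lemma locating_dominating_king_circulantI:
  assumes nd: "5 \<le> d" "4 * d + 5 \<le> n" and C: "C \<subseteq> {0..<n}"
    and dom: "\<And>x. \<exists>i j. king_near i j 0 0 \<and> window n d C x i j"
    and sep: "\<And>x a b. \<bar>a\<bar> \<le> 2 \<Longrightarrow> \<bar>b\<bar> \<le> 2 \<Longrightarrow> (a, b) \<noteq> (0, 0) \<Longrightarrow>
      \<not> window n d C x 0 0 \<Longrightarrow> \<not> window n d C x a b \<Longrightarrow> king_separated (window n d C x) 0 0 a b"
  shows "locating_dominating_code (circulant n {1, d - 1, d, d + 1}) C"
    (is "locating_dominating_code ?G C")
proof -
  have verts: "verts ?G = {0..<n}" by (simp add: circulant_def)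
  have D: "dominating_code ?G C" using dominating_king_circulant_iff[of n C d] nd C dom by auto
  have False
    if uv: "u \<in> {0..<n} - C" "v \<in> {0..<n} - C" and h: "u \<noteq> v" "I_set ?G C u = I_set ?G C v" for u v
  proof -
    have u: "u \<in> {0..<n}" and v: "v \<in> {0..<n}" using uv by auto
    have "I_set ?G C u \<noteq> {}" using D u unfolding dominating_code_def verts by blast
    then obtain a b where ab: "\<bar>a\<bar> \<le> 2" "\<bar>b\<bar> \<le> 2" "(a, b) \<noteq> (0, 0)" "v = (u + a + d * b) mod n"
      using I_set_eq_imp_near[OF u v h] by blast
    have "\<not> window n d C u 0 0" "\<not> window n d C u a b"
      using uv ab(4) unfolding window_def by auto
    then show False using sep ab I_set_eq_iff_not_separated[OF nd u ab(1,2,4)] h(2) by blast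
  qed
  then show ?thesis unfolding locating_dominating_code_def verts using D by blast
qed

lemma locating_dominating_king_circulant_card:
  assumes nd: "5 \<le> d" "4 * d + 5 \<le> n"
    and LD: "locating_dominating_code (circulant n {1, d - 1, d, d + 1}) C"
  shows "n \<le> 5 * int (card C)"
proof -
  let ?G = "circulant n {1, d - 1, d, d + 1}"
  define c where "c x \<longleftrightarrow> x mod n \<in> C" for x
  have n: "0 < n" using nd by linarith
  have verts: "verts ?G = {0..<n}" by (simp add: circulant_def)
  have D: "dominating_code ?G C"
    and L: "\<And>u v. u \<in> {0..<n} - C \<Longrightarrow> v \<in> {0..<n} - C \<Longrightarrow> u \<noteq> v \<Longrightarrow> I_set ?G C u \<noteq> I_set ?G C v"
    using LD unfolding locating_dominating_code_def verts by auto
  have C: "C \<subseteq> {0..<n}" using D unfolding dominating_code_def is_code_def verts by blast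
  have win: "(\<lambda>i j. c (x + i + d * j)) = window n d C x" for x
    by (intro ext) (simp only: c_def window_def)
  have "n \<le> 5 * (\<Sum>x\<in>{0..<n}. of_bool (c x))"
  proof (rule king_locating_dominating_bound[where d = d])
    show "0 < n" by (rule n)
    show "c (x mod n) = c x" for x by (simp add: c_def)
    show "1 \<le> king_count (\<lambda>i j. c (x + i + d * j))" for x
    proof -
      obtain i j where ij: "king_near i j 0 0" "window n d C x i j"
        using D dominating_king_circulant_iff[OF n C] by blast
      then have "(i, j) \<in> {-1,0,1} \<times> {-1,0,1}"
        unfolding king_near_def diff_0_right abs_le_1_iff[symmetric] by blast
      then have "of_bool (window n d C x i j) \<le> (\<Sum>(i, j)\<in>{-1,0,1} \<times> {-1,0,1}. of_bool (window n d C x i j) :: int)"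
        using member_le_sum[of "(i, j)" "{-1,0,1} \<times> {-1,0,1}" "\<lambda>(i, j). of_bool (window n d C x i j) :: int"]
        by (simp only: prod.case) auto
      also have "\<dots> = king_count (window n d C x)"
        unfolding king_count_def sum.cartesian_product ..
      finally show ?thesis using ij(2) unfolding win by simp
    qed
    fix x a b a' b' :: int
    assume O: "a \<in> {-1,0,1}" "b \<in> {-1,0,1}" "a' \<in> {-1,0,1}" "b' \<in> {-1,0,1}"
      and ne: "(a, b) \<noteq> (a', b')" and nc: "\<not> c (x + a + d * b)" "\<not> c (x + a' + d * b')"
    define u v where "u = (x + a + d * b) mod n" and "v = (x + a' + d * b') mod n"
    have small: "\<bar>a' - a\<bar> \<le> 2" "\<bar>b' - b\<bar> \<le> 2" using O unfolding abs_le_1_iff by linarith+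
    have u: "u \<in> {0..<n} - C" and v: "v \<in> {0..<n} - C"
      using nc n unfolding u_def v_def c_def by auto
    have veq: "v = (u + (a' - a) + d * (b' - b)) mod n"
      unfolding u_def v_def mod_shift by (simp add: algebra_simps)
    have "u \<noteq> v"
    proof
      assume "u = v"
      then have "n dvd (x + a' + d * b') - (x + a + d * b)"
        unfolding u_def v_def by (metis mod_eq_dvd_iff)
      then have "n dvd (a' - a) + d * (b' - b)" by (simp add: algebra_simps)
      then show False using small_combination_eq_0[OF nd, of "a' - a" "b' - b"] small ne by auto
    qed
    \<comment> \<open>The window is centred at \<open>u\<close> to compare \<open>I\<close>-sets,
      and then translated back to the centre \<open>x\<close>.\<close>
    then have "king_separated (window n d C u) 0 0 (a' - a) (b' - b)"
      using L[OF u v] I_set_eq_iff_not_separated[OF nd _ small veq] u by blast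
    moreover have "window n d C u = (\<lambda>i j. window n d C x (a + i) (b + j))"
      unfolding u_def window_mod window_shift ..
    ultimately show "king_separated (\<lambda>i j. c (x + i + d * j)) a b a' b'"
      unfolding win by (simp add: king_separated_shift)
  qed
  also have "(\<Sum>x\<in>{0..<n}. of_bool (c x)) = int (card C)"
  proof -
    have "{0..<n} \<inter> {x. c x} = C" using C by (auto simp: c_def)
    then show ?thesis by simp
  qed
  finally show ?thesis .
qed

subsection \<open>Constructions\<close>

lemma abs_le_2_cases: "\<bar>a\<bar> \<le> (2::int) \<Longrightarrow> a \<in> set [-2..2]"
  unfolding set_upto by auto

section \<open>Locating-dominating codes of density 1/5\<close>

definition decimal_pattern :: "int \<Rightarrow> bool" where
  "decimal_pattern x \<longleftrightarrow> x mod 10 \<in> {0, 4}"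

text \<open>Since \<open>d\<close> is 8 modulo 10, the residue of \<open>x + i + d * j\<close>
  modulo 10 is unchanged when 8 replaces \<open>d\<close>. This leaves a check of ten centres for
  all \<open>d\<close> at once.\<close>

lemma decimal_pattern_dominating:
  "\<forall>r\<in>set [0..9]. \<exists>i\<in>set [-1..1]. \<exists>j\<in>set [-1..1]. king_near i j 0 0 \<and> decimal_pattern (r + i + 8 * j)"
  by code_simp

text \<open>The neighbourhoods of the origin and of \<open>(a, b)\<close> reach coordinates of size
  at most 3, hence the search range.\<close>

lemma decimal_pattern_separated:
  "\<forall>r\<in>set [0..9]. \<forall>a\<in>set [-2..2]. \<forall>b\<in>set [-2..2].
    (a, b) = (0, 0) \<or> decimal_pattern (r + 0 + 8 * 0) \<or> decimal_pattern (r + a + 8 * b) \<or>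
    (\<exists>i\<in>set [-3..3]. \<exists>j\<in>set [-3..3].
      decimal_pattern (r + i + 8 * j) \<and> king_near i j 0 0 \<noteq> king_near i j a b)"
  by code_simp

lemma locating_dominating_king_circulant_exists:
  fixes n d :: int
  assumes d: "[d = 8] (mod 10)" "8 \<le> d" and n: "4 * d + 6 \<le> n" "[n = 0] (mod 10)"
  shows "\<exists>C. locating_dominating_code (circulant n {1, d - 1, d, d + 1}) C \<and> 5 * int (card C) = n"
proof -
  obtain m where m: "n = 10 * m" using n(2) by (auto simp: cong_0_iff)
  \<comment> \<open>Block number and residue as coordinates give the size \<open>2 * m\<close>; as
    10 divides \<open>n\<close>, membership depends on the residue modulo 10 only.\<close>
  define C where "C = (\<lambda>(q, r). 10 * q + r) ` ({0..<m} \<times> {0, 4 :: int})"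
  have n0: "0 < n" "0 < m" using d n m by auto
  have mem: "x mod n \<in> C \<longleftrightarrow> x mod 10 \<in> {0, 4}" for x
  proof
    assume "x mod n \<in> C"
    then obtain q r where "x mod n = 10 * q + r" "r \<in> {0, 4}" unfolding C_def by auto
    moreover have "x mod n mod 10 = x mod 10" by (simp add: m mod_mod_cancel)
    ultimately show "x mod 10 \<in> {0, 4}" by auto
  next
    assume r: "x mod 10 \<in> {0, 4}"
    have "x mod n mod 10 = x mod 10" by (simp add: m mod_mod_cancel)
    then have eq: "x mod n = 10 * (x mod n div 10) + x mod 10" by (metis mult_div_mod_eq)
    have "0 \<le> x mod n" "x mod n < n" using n0 by auto
    then have "x mod n div 10 \<in> {0..<m}" using m by auto
    then show "x mod n \<in> C" unfolding C_def using r eq by (intro image_eqI[of _ _ "(x mod n div 10, x mod 10)"]) auto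
  qed
  have sub: "C \<subseteq> {0..<n}" unfolding C_def m by auto
  have win: "window n d C x i j \<longleftrightarrow> decimal_pattern (x mod 10 + i + 8 * j)" for x i j
  proof -
    have "[x + i + d * j = x mod 10 + i + 8 * j] (mod 10)"
      using d(1) by (intro cong_add cong_mult cong_refl) (simp_all add: cong_def)
    then show ?thesis unfolding window_def mem decimal_pattern_def cong_def by simp
  qed
  have res: "x mod 10 \<in> set [0..9]" for x :: int unfolding set_upto by auto
  have "locating_dominating_code (circulant n {1, d - 1, d, d + 1}) C"
  proof (rule locating_dominating_king_circulantI)
    show "5 \<le> d" "4 * d + 5 \<le> n" "C \<subseteq> {0..<n}" using d n sub by auto
    show "\<exists>i j. king_near i j 0 0 \<and> window n d C x i j" for x
      using bspec[OF decimal_pattern_dominating res[of x]] unfolding win by blast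
    show "king_separated (window n d C x) 0 0 a b"
      if ab: "\<bar>a\<bar> \<le> 2" "\<bar>b\<bar> \<le> 2" "(a, b) \<noteq> (0, 0)"
        and nc: "\<not> window n d C x 0 0" "\<not> window n d C x a b" for x a b
      using decimal_pattern_separated[THEN bspec, OF res, THEN bspec, OF abs_le_2_cases[OF ab(1)],
          THEN bspec, OF abs_le_2_cases[OF ab(2)], of x] ab(3) nc
      unfolding win king_separated_def by blast
  qed
  moreover have "card C = card ({0..<m} \<times> {0, 4 :: int})"
    unfolding C_def by (rule card_image) (auto simp: inj_on_def, presburger+)
  then have "int (card C) = 2 * m" using n0 by (simp add: card_cartesian_product)
  then have "5 * int (card C) = n" using m by simp
  ultimately show ?thesis by blast
qed

lemma gamma_LD_eqI:
  assumes "locating_dominating_code G C" "card C = k"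
    and "\<And>C'. locating_dominating_code G C' \<Longrightarrow> k \<le> card C'" and "finite (verts G)"
  shows "gamma_LD G = k"
  unfolding gamma_LD_def
proof (rule Min_eqI)
  have "{C. locating_dominating_code G C} \<subseteq> Pow (verts G)"
    by (auto simp: locating_dominating_code_def dominating_code_def is_code_def)
  then show "finite (card ` {C. locating_dominating_code G C})"
    using assms(4) by (meson finite_Pow_iff finite_imageI finite_subset)
qed (use assms in auto)

section \<open>Identifying codes of density tending to 2/9\<close>

text \<open>An identifying code of density 2/9 in the king grid; its period lattice is generated by
  \<open>(6, 0)\<close> and \<open>(3, 3)\<close>.\<close>

definition king_pattern :: "int \<Rightarrow> int \<Rightarrow> bool" where
  "king_pattern i j \<longleftrightarrow>
    (i mod 6, j mod 6) \<in> {(2, 0), (0, 1), (4, 1), (2, 2), (5, 3), (3, 4), (1, 4), (5, 5)}"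

lemma king_pattern_dominating:
  "\<forall>x\<in>set [0..5]. \<forall>y\<in>set [0..5].
    \<exists>i\<in>set [-1..1]. \<exists>j\<in>set [-1..1]. king_near i j 0 0 \<and> king_pattern (x + i) (y + j)"
  by code_simp

lemma king_pattern_separated:
  "\<forall>x\<in>set [0..5]. \<forall>y\<in>set [0..5]. \<forall>a\<in>set [-2..2]. \<forall>b\<in>set [-2..2]. (a, b) = (0, 0) \<or>
    (\<exists>i\<in>set [-3..3]. \<exists>j\<in>set [-3..3].
      king_pattern (x + i) (y + j) \<and> king_near i j 0 0 \<noteq> king_near i j a b)"
  by code_simp

lemma king_separated_mono:
  assumes "king_separated V 0 0 a b" "\<bar>a\<bar> \<le> 2"
    and "\<And>i j. V i j \<Longrightarrow> \<bar>i\<bar> \<le> 3 \<Longrightarrow> W i j"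
  shows "king_separated W 0 0 a b"
proof -
  obtain i j where ij: "V i j" "king_near i j 0 0 \<noteq> king_near i j a b"
    using assms(1) unfolding king_separated_def by blast
  then have "king_near i j 0 0 \<or> king_near i j a b" by blast
  then have "\<bar>i\<bar> \<le> 3" using assms(2) unfolding king_near_def by linarith
  then show ?thesis using assms(3) ij unfolding king_separated_def by blast
qed

text \<open>In the circulant graph the end of each row of length \<open>d\<close> is glued to the start of the next row.
  The three columns on either side of this seam are filled up completely: then inside a window that
  meets the seam every vertex is a codeword if it lies beyond the seam, so the code always contains
  the unbroken pattern continued from the centre of the window. A superset of an identifying code is
  identifying.\<close>

definition spiral_code :: "int \<Rightarrow> int set" where
  "spiral_code d = {x \<in> {0..<6 * d}. king_pattern (x mod d) (x div d) \<or> x mod d < 3 \<or> d - 3 \<le> x mod d}"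

lemma identifying_spiral_code:
  assumes d: "5 \<le> d"
  shows "identifying_code (circulant (6 * d) {1, d - 1, d, d + 1}) (spiral_code d)"
proof -
  define n where "n = 6 * d"
  have win: "window n d (spiral_code d) x i j \<longleftrightarrow>
      king_pattern ((x + i) mod d) ((x + i) div d + j) \<or> (x + i) mod d < 3 \<or> d - 3 \<le> (x + i) mod d" for x i j
  proof -
    let ?y = "x + i + d * j"
    have 1: "?y mod n mod d = (x + i) mod d" unfolding n_def by (simp add: mod_mod_cancel)
    \<comment> \<open>There are six rows and the pattern has period 6 in \<open>j\<close>, so the
      last row continues into the first without a second seam.\<close>
    have "?y mod n = d * (?y div d mod 6) + ?y mod d"
      unfolding n_def using zmod_zmult2_eq[of 6 ?y d] by (simp add: mult.commute)
    then have "?y mod n div d = ?y div d mod 6" using d by simp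
    also have "?y div d = (x + i) div d + j" using d by simp
    finally have 2: "king_pattern p (?y mod n div d) = king_pattern p ((x + i) div d + j)" for p
      by (simp add: king_pattern_def)
    show ?thesis unfolding window_def spiral_code_def using 1 2 d by (simp add: n_def)
  qed
  have cover: "window n d (spiral_code d) x i j"
    if pat: "king_pattern (x mod d mod 6 + i) (x div d mod 6 + j)" and i: "\<bar>i\<bar> \<le> 3" for x i j
  proof -
    define p q where "p = x mod d" and "q = x div d"
    have pq: "x + i = p + i + d * q" "0 \<le> p" "p < d" unfolding p_def q_def using d by auto
    \<comment> \<open>A shift by at most 3 crosses the seam at most once, as
      \<open>5 \<le> d\<close>, and then lands in the filled columns on the far side.\<close>
    consider "p + i < 0" | "0 \<le> p + i" "p + i < d" | "d \<le> p + i" by linarith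
    then show ?thesis
    proof cases
      case 1
      have "(x + i) mod d = (p + i + d) mod d" unfolding pq(1) by (simp add: mod_simps)
      also have "\<dots> = p + i + d" using 1 pq i d by (intro mod_pos_pos_trivial) linarith+
      finally have "d - 3 \<le> (x + i) mod d" using pq(2) i by linarith
      then show ?thesis unfolding win by blast
    next
      case 2
      have "king_pattern (p + i) (q + j)"
        using pat unfolding king_pattern_def p_def q_def by (simp add: mod_simps)
      moreover have "(x + i) mod d = p + i" "(x + i) div d = q" unfolding pq(1) using 2 by simp_all
      ultimately show ?thesis unfolding win by simp
    next
      case 3
      have "(x + i) mod d = (p + i - d) mod d" unfolding pq(1) by (simp add: mod_simps)
      also have "\<dots> = p + i - d" using 3 pq i d by (intro mod_pos_pos_trivial) linarith+
      finally have "(x + i) mod d < 3" using pq(3) i by linarith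
      then show ?thesis unfolding win by blast
    qed
  qed
  have res: "x mod 6 \<in> set [0..5]" for x :: int unfolding set_upto by auto
  show ?thesis unfolding n_def[symmetric]
  proof (rule identifying_king_circulantI)
    show "5 \<le> d" "4 * d + 5 \<le> n" "spiral_code d \<subseteq> {0..<n}"
      using d by (auto simp: n_def spiral_code_def)
    show "\<exists>i j. king_near i j 0 0 \<and> window n d (spiral_code d) x i j" for x
    proof -
      obtain i j where "king_near i j 0 0" "king_pattern (x mod d mod 6 + i) (x div d mod 6 + j)"
        using king_pattern_dominating[THEN bspec, OF res, THEN bspec, OF res, of "x mod d" "x div d"]
        by blast
      moreover from this(1) have "\<bar>i\<bar> \<le> 3" unfolding king_near_def by linarith
      ultimately show ?thesis using cover by blast
    qed
    show "king_separated (window n d (spiral_code d) x) 0 0 a b"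
      if ab: "\<bar>a\<bar> \<le> 2" "\<bar>b\<bar> \<le> 2" "(a, b) \<noteq> (0, 0)" for x a b
    proof (rule king_separated_mono[OF _ ab(1) cover])
      show "king_separated (\<lambda>i j. king_pattern (x mod d mod 6 + i) (x div d mod 6 + j)) 0 0 a b"
        using king_pattern_separated[THEN bspec, OF res, THEN bspec, OF res, THEN bspec,
            OF abs_le_2_cases[OF ab(1)], THEN bspec, OF abs_le_2_cases[OF ab(2)], of "x mod d" "x div d"] ab(3)
        unfolding king_separated_def by blast
    qed
  qed
qed

text \<open>The six rows of length \<open>6 * k\<close> form \<open>k\<close> square blocks with
  eight pattern codewords each, the set \<open>B\<close>. The seam \<open>S\<close> adds at most six
  columns of six vertices.\<close>

lemma card_spiral_code:
  assumes k: "1 \<le> k"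
  shows "8 * k \<le> int (card (spiral_code (6 * k)))" "int (card (spiral_code (6 * k))) \<le> 8 * k + 36"
proof -
  define P :: "(int \<times> int) set" where
    "P = {(2, 0), (0, 1), (4, 1), (2, 2), (5, 3), (3, 4), (1, 4), (5, 5)}"
  \<comment> \<open>Cell \<open>(i, j)\<close> of block \<open>a\<close> is in column
    \<open>6 * a + i\<close> of row \<open>j\<close>; remainder and quotient by \<open>6 * k\<close>
    recover column and row.\<close>
  define f where "f = (\<lambda>(a, i, j). 6 * a + i + 6 * k * j)"
  define B where "B = f ` ({0..<k} \<times> P)"
  define S where "S = (\<lambda>(i, j). i + 6 * k * j) ` (({0..<3} \<union> {6 * k - 3..<6 * k}) \<times> {0..<6})"
  have P: "0 \<le> i \<and> i < 6 \<and> 0 \<le> j \<and> j < 6" if "(i, j) \<in> P" for i j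
    using that unfolding P_def by auto
  have f: "f (a, i, j) mod (6 * k) = 6 * a + i" "f (a, i, j) div (6 * k) = j"
    if "a \<in> {0..<k}" "(i, j) \<in> P" for a i j
    using that P[OF that(2)] by (auto simp: f_def)
  have "inj_on f ({0..<k} \<times> P)"
  proof (rule inj_onI)
    fix s t assume s: "s \<in> {0..<k} \<times> P" and t: "t \<in> {0..<k} \<times> P" and eq: "f s = f t"
    obtain a i j a' i' j' where st: "s = (a, i, j)" "t = (a', i', j')" by (metis prod.exhaust)
    have "6 * a + i = 6 * a' + i'" "j = j'" using f[of a i j] f[of a' i' j'] s t eq unfolding st by auto
    moreover have "0 \<le> i" "i < 6" "0 \<le> i'" "i' < 6" using P s t unfolding st by auto
    ultimately have "a = a' \<and> i = i' \<and> j = j'" by presburger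
    then show "s = t" unfolding st by simp
  qed
  then have "card B = card ({0..<k} \<times> P)" unfolding B_def by (rule card_image)
  then have card_B: "int (card B) = 8 * k" using k by (simp add: card_cartesian_product P_def)
  have card_S: "card S \<le> 36"
  proof -
    have "card S \<le> card (({0..<3} \<union> {6 * k - 3..<6 * k}) \<times> {0..<6::int})"
      unfolding S_def by (intro card_image_le) auto
    also have "\<dots> \<le> (3 + 3) * 6"
      unfolding card_cartesian_product
      using card_Un_le[of "{0..<3::int}" "{6 * k - 3..<6 * k}"] by (intro mult_mono) auto
    finally show ?thesis by simp
  qed
  have fin: "finite (spiral_code (6 * k))"
    unfolding spiral_code_def by (rule finite_subset[of _ "{0..<6 * (6 * k)}"]) auto
  have "B \<subseteq> spiral_code (6 * k)"
  proof
    fix x assume "x \<in> B"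
    then obtain a i j where x: "x = f (a, i, j)" and a: "a \<in> {0..<k}" and ij: "(i, j) \<in> P"
      unfolding B_def by auto
    have "king_pattern (x mod (6 * k)) (x div (6 * k))"
      unfolding x f[OF a ij] king_pattern_def P_def[symmetric] using P[OF ij] ij by simp
    moreover have "0 \<le> x"
      using a P[OF ij] k by (simp add: x f_def)
    moreover have "x < 6 * (6 * k)"
    proof -
      have "6 * k * j \<le> 6 * k * 5" using P[OF ij] k by (intro mult_left_mono) auto
      moreover have "6 * a + i < 6 * k" using a P[OF ij] by auto
      moreover have "x = 6 * a + i + 6 * k * j" by (simp add: x f_def)
      ultimately show ?thesis by linarith
    qed
    ultimately show "x \<in> spiral_code (6 * k)" unfolding spiral_code_def by simp
  qed
  from card_mono[OF fin this] show "8 * k \<le> int (card (spiral_code (6 * k)))"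
    using card_B by linarith
  have "spiral_code (6 * k) \<subseteq> B \<union> S"
  proof
    fix x assume x: "x \<in> spiral_code (6 * k)"
    define p q where "p = x mod (6 * k)" and "q = x div (6 * k)"
    have xeq: "x = p + 6 * k * q" unfolding p_def q_def by simp
    have p: "0 \<le> p" "p < 6 * k" unfolding p_def using k by auto
    have x2: "0 \<le> x" "x < 6 * (6 * k)" using x unfolding spiral_code_def by auto
    have q: "0 \<le> q" "q < 6"
    proof -
      show "0 \<le> q" unfolding q_def using x2 k by (simp add: pos_imp_zdiv_nonneg_iff)
      show "q < 6"
      proof (rule ccontr)
        assume "\<not> q < 6"
        then have "6 * k * 6 \<le> 6 * k * q" using k by (intro mult_left_mono) auto
        then show False using xeq p(1) x2(2) by linarith
      qed
    qed
    show "x \<in> B \<union> S"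
    proof (cases "p < 3 \<or> 6 * k - 3 \<le> p")
      case True
      then have "x \<in> S" unfolding S_def using p q xeq by (intro image_eqI[of _ _ "(p, q)"]) auto
      then show ?thesis ..
    next
      case False
      then have "king_pattern p q" using x unfolding spiral_code_def p_def q_def by auto
      then have "(p mod 6, q) \<in> P" using q unfolding king_pattern_def P_def by simp
      moreover have "p div 6 \<in> {0..<k}" using p by auto
      moreover have "x = f (p div 6, p mod 6, q)" unfolding f_def using xeq by simp
      ultimately have "x \<in> B" unfolding B_def by blast
      then show ?thesis ..
    qed
  qed
  moreover have "finite (B \<union> S)" unfolding B_def S_def P_def by auto
  ultimately have "card (spiral_code (6 * k)) \<le> card (B \<union> S)" by (intro card_mono)
  also have "\<dots> \<le> card B + card S" by (rule card_Un_le)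
  finally show "int (card (spiral_code (6 * k))) \<le> 8 * k + 36" using card_B card_S by linarith
qed

theorem theorem6:
  shows "(\<forall>n d :: int. [d = 8] (mod 10) \<and> d \<ge> 8 \<and> n \<ge> 4 * d + 6 \<and> [n = 0] (mod 10) \<longrightarrow>
           real (gamma_LD (circulant n {1, d - 1, d, d + 1})) = real_of_int n / 5)
       \<and> (\<exists>(n :: nat \<Rightarrow> int) (d :: nat \<Rightarrow> int) (C :: nat \<Rightarrow> int set).
           (\<forall>k\<ge>1. d k \<ge> 3 \<and> real_of_int (d k + 1) \<le> real_of_int (n k) / 2 \<and>
              identifying_code (circulant (n k) {1, d k - 1, d k, d k + 1}) (C k)) \<and>
           (\<lambda>k. real (card (C k)) / real_of_int (n k)) \<longlonglongrightarrow> 2 / 9)"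
proof (intro conjI allI impI)
  fix n d :: int
  assume nd: "[d = 8] (mod 10) \<and> d \<ge> 8 \<and> n \<ge> 4 * d + 6 \<and> [n = 0] (mod 10)"
  let ?G = "circulant n {1, d - 1, d, d + 1}"
  obtain C where C: "locating_dominating_code ?G C" "5 * int (card C) = n"
    using locating_dominating_king_circulant_exists[of d n] nd by auto
  have "gamma_LD ?G = card C"
  proof (rule gamma_LD_eqI[OF C(1) refl])
    fix C' assume "locating_dominating_code ?G C'"
    then have "n \<le> 5 * int (card C')"
      using nd by (intro locating_dominating_king_circulant_card[of d n]) auto
    then show "card C \<le> card C'" using C(2) by linarith
  qed (simp add: circulant_def)
  moreover have "5 * real (card C) = real_of_int n" using C(2) by (metis of_int_mult of_int_numeral of_int_of_nat_eq)
  ultimately show "real (gamma_LD ?G) = real_of_int n / 5" by simp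
next
  \<comment> \<open>A multiple of 6 makes whole blocks fit into a row; the shift by 1 keeps
    \<open>d k\<close> at least 6 also for \<open>k = 0\<close>.\<close>
  define d where "d k = 6 * (int k + 1)" for k
  define r where "r k = real (card (spiral_code (d k))) / real_of_int (6 * d k)" for k
  \<comment> \<open>At most 36 seam codewords among \<open>36 * (k + 1)\<close> vertices account for
    the error term.\<close>
  have bounds: "2 / 9 \<le> r k" "r k \<le> 2 / 9 + inverse (real (Suc k))" for k
  proof -
    define m where "m = card (spiral_code (d k))"
    have "1 \<le> int k + 1" by simp
    from card_spiral_code[OF this] have "8 * (int k + 1) \<le> int m" "int m \<le> 8 * (int k + 1) + 36"
      unfolding m_def d_def .
    then have "8 * (k + 1) \<le> m" "m \<le> 8 * (k + 1) + 36" by auto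
    then have m: "real (8 * (k + 1)) \<le> real m" "real m \<le> real (8 * (k + 1) + 36)"
      by (simp_all only: of_nat_le_iff)
    have r: "r k = real m / (36 * real (Suc k))" by (simp add: r_def m_def d_def algebra_simps)
    have "2 / 9 = real (8 * (k + 1)) / (36 * real (Suc k))" by (simp add: field_simps)
    also have "\<dots> \<le> r k" unfolding r using m by (intro divide_right_mono) auto
    finally show "2 / 9 \<le> r k" .
    have "r k \<le> real (8 * (k + 1) + 36) / (36 * real (Suc k))"
      unfolding r using m by (intro divide_right_mono) auto
    also have "\<dots> = 2 / 9 + inverse (real (Suc k))" by (simp add: field_simps)
    finally show "r k \<le> 2 / 9 + inverse (real (Suc k))" .
  qed
  have "r \<longlonglongrightarrow> 2 / 9"
  proof (rule tendsto_sandwich[OF _ _ tendsto_const])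
    show "(\<lambda>k. 2 / 9 + inverse (real (Suc k))) \<longlonglongrightarrow> 2 / 9"
      using tendsto_add[OF tendsto_const LIMSEQ_inverse_real_of_nat, of "2 / 9"] by simp
  qed (use bounds in auto)
  moreover have "identifying_code (circulant (6 * d k) {1, d k - 1, d k, d k + 1}) (spiral_code (d k))" for k
    by (rule identifying_spiral_code) (simp add: d_def)
  moreover have "d k \<ge> 3" "real_of_int (d k + 1) \<le> real_of_int (6 * d k) / 2" for k
    by (simp_all add: d_def)
  ultimately show "\<exists>(n :: nat \<Rightarrow> int) (d :: nat \<Rightarrow> int) (C :: nat \<Rightarrow> int set).
      (\<forall>k\<ge>1. d k \<ge> 3 \<and> real_of_int (d k + 1) \<le> real_of_int (n k) / 2 \<and>
        identifying_code (circulant (n k) {1, d k - 1, d k, d k + 1}) (C k)) \<and>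
      (\<lambda>k. real (card (C k)) / real_of_int (n k)) \<longlonglongrightarrow> 2 / 9"
    unfolding r_def
    by (intro exI[of _ "\<lambda>k. 6 * d k"] exI[of _ d] exI[of _ "\<lambda>k. spiral_code (d k)"]) simp
qed

end
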